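(* Let $\mathcal{F}\subseteq 2^{[n]}$ be such that the vertex sets of the components of $G_\mathcal{F}$ are diamonds $\mathcal{F}_1,\dots,\mathcal{F}_\ell$. For $i,j\in\{0,\dots,n\}$ let $a_{i,j}$ be the number of these components whose bottom corner has size $i$ and whose top corner has size $i+j$. Then \[ \sum_{i=0}^n\sum_{j=0}^n\frac{a_{i,j}}{\binom{n-j}{i}}\le 1. \]
   Context: For $\mathcal{F}\subseteq 2^{[n]}$, $G_\mathcal{F}$ is the graph on $\mathcal{F}$ with distinct $A,B$ adjacent iff $A\subseteq B$ or $B\subseteq A$. A diamond is a family of the form $\{X: A\subseteq X\subseteq B\}$ for some $A\subseteq B\subseteq[n]$; $A$ is its bottom corner and $B$ its top corner. *)

theory Defs
  imports Complex_Main "Graph_Theory.Digraph_Component"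
begin

text \<open>Undirected graphs are modelled, as usual in this library, as symmetric digraphs.\<close>

definition comparability_graph :: "'a set set \<Rightarrow> 'a set pair_pre_digraph" where
  "comparability_graph F =
     \<lparr> pverts = F, parcs = {(A, B). A \<in> F \<and> B \<in> F \<and> A \<noteq> B \<and> (A \<subseteq> B \<or> B \<subseteq> A)} \<rparr>"

lemma pair_graph_comparability_graph:
  assumes "finite F"
  shows "pair_graph (comparability_graph F)"
proof
  have "parcs (comparability_graph F) \<subseteq> F \<times> F"
    by (auto simp: comparability_graph_def)
  then show "finite (parcs (comparability_graph F))"
    using assms by (meson finite_SigmaI finite_subset)
qed (use assms in \<open>auto simp: comparability_graph_def symmetric_def sym_def arcs_ends_def arc_to_ends_def\<close>)

text \<open>In a symmetric digraph the strongly connected components are the connected components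
  of the undirected graph.\<close>

definition component_sets :: "'a set set \<Rightarrow> 'a set set set" where
  "component_sets F = pre_digraph.sccs_verts (with_proj (comparability_graph F))"

text \<open>For sets, \<open>{A..B}\<close> is \<open>{X. A \<subseteq> X \<and> X \<subseteq> B}\<close>.\<close>

definition diamond_with_corners :: "'a set set \<Rightarrow> 'a set \<Rightarrow> 'a set \<Rightarrow> bool" where
  "diamond_with_corners D A B \<longleftrightarrow> A \<subseteq> B \<and> D = {A..B}"

definition diamond :: "nat \<Rightarrow> nat set set \<Rightarrow> bool" where
  "diamond n D \<longleftrightarrow> (\<exists>A B. B \<subseteq> {1..n} \<and> diamond_with_corners D A B)"

definition num_components :: "nat set set \<Rightarrow> nat \<Rightarrow> nat \<Rightarrow> nat" where
  "num_components F i j =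
     card {D \<in> component_sets F. \<exists>A B. diamond_with_corners D A B \<and> card A = i \<and> card B = i + j}"

end

theory Submission
  imports Defs
begin

text \<open>Let \<open>D\<^sub>k = {A\<^sub>k..B\<^sub>k}\<close> be the components and \<open>C\<^sub>k\<close> the complement of \<open>B\<^sub>k\<close>. Then
  \<open>A\<^sub>k \<inter> C\<^sub>k = {}\<close>, whereas \<open>A\<^sub>k \<inter> C\<^sub>l \<noteq> {}\<close> for \<open>k \<noteq> l\<close>, since \<open>A\<^sub>k \<subseteq> B\<^sub>l\<close> would merge the two
  components. As \<open>|A\<^sub>k| + |C\<^sub>k| = n - |B\<^sub>k - A\<^sub>k|\<close>, the claim is Bollobas's inequality for the
  set pairs \<open>(A\<^sub>k, C\<^sub>k)\<close>. That inequality follows by induction on the ground set \<open>X\<close>: for each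
  \<open>x \<in> X\<close> apply it to the pairs \<open>(A\<^sub>k, C\<^sub>k - {x})\<close> with \<open>x \<notin> A\<^sub>k\<close>, and sum over \<open>x\<close>.\<close>

lemma inverse_binomial_step:
  assumes "0 < c"
  shows "real c / real ((a + c - 1) choose a) = real (a + c) / real ((a + c) choose a)"
proof -
  have "c * ((a + c) choose a) = (a + c) * ((a + c - 1) choose a)"
    using binomial_absorb_comp[of "a + c" a] by simp
  then have "real c * real ((a + c) choose a) = real (a + c) * real ((a + c - 1) choose a)"
    by (metis of_nat_mult)
  moreover have "(a + c) choose a > 0" "(a + c - 1) choose a > 0"
    using assms by (simp_all add: zero_less_binomial)
  ultimately show ?thesis
    by (simp add: field_simps)
qed

text \<open>Write \<open>N\<close> for the binomial coefficient on the right, \<open>a\<close> and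
  \<open>c\<close> for the cardinalities of \<open>A\<close> and \<open>C\<close>. Deleting a point
  of \<open>C\<close> lowers \<open>c\<close> by one, and by absorption these \<open>c\<close> terms
  add up to \<open>(a + c) / N\<close>. Each of the other \<open>card X - (a + c)\<close> points
  leaves \<open>C\<close> unchanged and contributes \<open>1 / N\<close>.\<close>

lemma sum_inverse_binomial_delete:
  fixes X A C :: "'a set"
  assumes X: "finite X" "A \<subseteq> X" "C \<subseteq> X" and disj: "A \<inter> C = {}" and "C \<noteq> {}"
  shows "(\<Sum>x\<in>X - A. 1 / real ((card A + card (C - {x})) choose card A))
       = real (card X) / real ((card A + card C) choose card A)"
proof -
  let ?a = "card A" and ?c = "card C"
  let ?N = "real ((?a + ?c) choose ?a)"
  have fin: "finite A" "finite C"
    using X finite_subset by auto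
  have c: "0 < ?c"
    using fin \<open>C \<noteq> {}\<close> by (simp add: card_gt_0_iff)
  have split: "X - A = C \<union> (X - (A \<union> C))"
    using X disj by auto
  have sumsplit: "sum f (X - A) = sum f C + sum f (X - (A \<union> C))" for f :: "'a \<Rightarrow> real"
    unfolding split using X fin by (intro sum.union_disjoint) auto
  have inC: "(\<Sum>x\<in>C. 1 / real ((?a + card (C - {x})) choose ?a)) = real (?a + ?c) / ?N"
    using inverse_binomial_step[OF c, of ?a] c fin by (simp add: card_Diff_singleton)
  have "card (X - (A \<union> C)) = card X - (?a + ?c)"
    using X fin disj by (simp add: card_Diff_subset card_Un_disjoint)
  moreover have "?a + ?c \<le> card X"
    using X fin disj by (metis card_Un_disjoint card_mono le_sup_iff)
  ultimately have outC: "(\<Sum>x\<in>X - (A \<union> C). 1 / real ((?a + card (C - {x})) choose ?a))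
      = (real (card X) - real (?a + ?c)) / ?N"
    by simp
  have "(\<Sum>x\<in>X - A. 1 / real ((?a + card (C - {x})) choose ?a))
      = real (?a + ?c) / ?N + (real (card X) - real (?a + ?c)) / ?N"
    unfolding inC[symmetric] outC[symmetric] by (rule sumsplit)
  also have "\<dots> = real (card X) / ?N"
    unfolding add_divide_distrib[symmetric] by simp
  finally show ?thesis .
qed

theorem bollobas_set_pairs:
  fixes A C :: "'i \<Rightarrow> 'a set"
  assumes "finite X" "finite I"
    and "\<And>i. i \<in> I \<Longrightarrow> A i \<subseteq> X" "\<And>i. i \<in> I \<Longrightarrow> C i \<subseteq> X"
    and "\<And>i. i \<in> I \<Longrightarrow> A i \<inter> C i = {}"
    and "\<And>i j. i \<in> I \<Longrightarrow> j \<in> I \<Longrightarrow> i \<noteq> j \<Longrightarrow> A i \<inter> C j \<noteq> {}"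
  shows "(\<Sum>i\<in>I. 1 / real ((card (A i) + card (C i)) choose card (A i))) \<le> 1"
  using assms
proof (induction "card X" arbitrary: X I C rule: less_induct)
  case less
  show ?case
  proof (cases "\<exists>i\<in>I. C i = {}")
    \<comment> \<open>Any second index \<open>j\<close> would need \<open>A j\<close> to meet the
      empty set \<open>C i\<close>, so \<open>i\<close> is the only index and the sum is the single
      term 1.\<close>
    case True
    then obtain i where "i \<in> I" "C i = {}" by blast
    then have "I = {i}"
      using less.prems(6) by blast
    then show ?thesis
      using \<open>C i = {}\<close> by simp
  next
    case False
    show ?thesis
    proof (cases "X = {}")
      case True
      then have "I = {}"
        using False less.prems(4) by blast
      then show ?thesis by simp
    next
      case nonempty: False
      let ?g = "\<lambda>x i. 1 / real ((card (A i) + card (C i - {x})) choose card (A i))"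
      \<comment> \<open>Restricting to \<open>x \<notin> A i\<close> keeps the cross-intersections:
        removing \<open>x\<close> from \<open>C j\<close> takes nothing away from
        \<open>A i \<inter> C j\<close>.\<close>
      have step: "(\<Sum>i\<in>{i\<in>I. x \<notin> A i}. ?g x i) \<le> 1" if "x \<in> X" for x
      proof (rule less.hyps[of "X - {x}"])
        show "card (X - {x}) < card X"
          using that less.prems(1) by (rule card_Diff1_less[rotated])
      qed (use less.prems in \<open>auto, blast+\<close>)
      have "real (card X) * (\<Sum>i\<in>I. 1 / real ((card (A i) + card (C i)) choose card (A i)))
          = (\<Sum>i\<in>I. \<Sum>x\<in>X - A i. ?g x i)"
        using False less.prems
        by (simp add: sum_distrib_left sum_inverse_binomial_delete)
      also have "\<dots> = (\<Sum>i\<in>I. \<Sum>x | x \<in> X \<and> x \<notin> A i. ?g x i)"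
        by (simp add: set_diff_eq)
      also have "\<dots> = (\<Sum>x\<in>X. \<Sum>i | i \<in> I \<and> x \<notin> A i. ?g x i)"
        using less.prems(1,2) by (intro sum.swap_restrict) auto
      also have "\<dots> \<le> real (card X)"
        using sum_mono[of X, OF step] by simp
      finally show ?thesis
        using nonempty less.prems(1) by (simp add: card_gt_0_iff)
    qed
  qed
qed

lemma component_sets_subset:
  assumes "finite F" "D \<in> component_sets F"
  shows "D \<subseteq> F"
proof -
  interpret pair_graph "comparability_graph F"
    by (rule pair_graph_comparability_graph[OF assms(1)])
  show ?thesis
    using sccs_verts_subsets assms(2)
    by (auto simp: component_sets_def comparability_graph_def)
qed

text \<open>Comparable sets are equal or joined by arcs in both directions, so they are mutually
  reachable. Maximality of a strong component then puts \<open>V\<close> into \<open>D\<close>, and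
  distinct components are disjoint.\<close>

lemma component_sets_eqI:
  assumes "finite F" and D: "D \<in> component_sets F" "E \<in> component_sets F"
    and U: "U \<in> D" "V \<in> E" "U \<subseteq> V"
  shows "D = E"
proof -
  interpret pair_graph "comparability_graph F"
    by (rule pair_graph_comparability_graph[OF assms(1)])
  let ?G = "with_proj (comparability_graph F)"
  have F: "U \<in> F" "V \<in> F"
    using component_sets_subset assms by blast+
  have "U \<rightarrow>\<^sup>*\<^bsub>?G\<^esub> V \<and> V \<rightarrow>\<^sup>*\<^bsub>?G\<^esub> U"
  proof (cases "U = V")
    case True
    moreover have "V \<in> pverts (comparability_graph F)"
      using F by (simp add: comparability_graph_def)
    ultimately show ?thesis
      by simp
  next
    case False
    then have "U \<rightarrow>\<^bsub>?G\<^esub> V" "V \<rightarrow>\<^bsub>?G\<^esub> U"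
      using F U by (auto simp: comparability_graph_def)
    then show ?thesis
      by simp
  qed
  then have "V \<in> D"
    using D(1) U(1) unfolding component_sets_def sccs_verts_def by simp metis
  then show ?thesis
    using sccs_verts_disjoint D U(2) unfolding component_sets_def by blast
qed

theorem theorem3p1:
  fixes n :: nat and F :: "nat set set"
  assumes "F \<subseteq> Pow {1..n}"
    and "\<forall>D \<in> component_sets F. diamond n D"
  shows "(\<Sum>i=0..n. \<Sum>j=0..n. real (num_components F i j) / real ((n - j) choose i)) \<le> 1"
proof -
  let ?K = "component_sets F" and ?X = "{1..n}"
  have finF: "finite F"
    using assms(1) finite_subset by blast
  have finK: "finite ?K"
    by (rule finite_subset[of _ "Pow F"]) (use component_sets_subset[OF finF] finF in auto)
  obtain A B where AB: "\<And>D. D \<in> ?K \<Longrightarrow> B D \<subseteq> ?X \<and> A D \<subseteq> B D \<and> D = {A D..B D}"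
    using assms(2) unfolding diamond_def diamond_with_corners_def by metis
  have fin: "finite (A D)" "finite (B D)" if "D \<in> ?K" for D
    using AB[OF that] by (meson finite_atLeastAtMost finite_subset)+
  have cards: "card (A D) \<le> card (B D)" "card (B D) \<le> n" if "D \<in> ?K" for D
    using AB[OF that] fin[OF that] card_mono[of ?X "B D"] by (auto intro: card_mono)
  \<comment> \<open>A nonempty interval determines its endpoints, so the existential in
    \<open>num_components\<close> speaks of the chosen \<open>A D\<close> and \<open>B D\<close>
    only.\<close>
  have corners: "diamond_with_corners D P Q \<longleftrightarrow> P = A D \<and> Q = B D" if "D \<in> ?K" for D P Q
    using AB[OF that] unfolding diamond_with_corners_def by (metis Icc_eq_Icc)
  define g where "g D = (card (A D), card (B D) - card (A D))" for D
  have num: "num_components F i j = card {D \<in> ?K. g D = (i, j)}" for i j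
    unfolding num_components_def g_def using corners cards(1)
    by (intro arg_cong[where f = card]) fastforce
  let ?h = "\<lambda>p. 1 / real ((n - snd p) choose fst p)"
  \<comment> \<open>The double sum is the sum over components, grouped by the index pair
    \<open>g D\<close>, which always lies in the square
    \<open>{0..n} \<times> {0..n}\<close>.\<close>
  have "(\<Sum>i=0..n. \<Sum>j=0..n. real (num_components F i j) / real ((n - j) choose i))
      = (\<Sum>p\<in>{0..n} \<times> {0..n}. \<Sum>D | D \<in> ?K \<and> g D = p. ?h (g D))"
    by (simp add: sum.cartesian_product num split_beta)
  also have "\<dots> = (\<Sum>D\<in>?K. ?h (g D))"
    by (rule sum.group) (use finK cards in \<open>fastforce simp: g_def\<close>)+
  also have "\<dots> = (\<Sum>D\<in>?K. 1 / real ((card (A D) + card (?X - B D)) choose card (A D)))"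
  proof (intro sum.cong refl)
    fix D assume D: "D \<in> ?K"
    have "card (?X - B D) = n - card (B D)"
      using AB[OF D] fin[OF D] by (simp add: card_Diff_subset)
    then have "n - snd (g D) = card (A D) + card (?X - B D)"
      using cards[OF D] by (simp add: g_def)
    then show "?h (g D) = 1 / real ((card (A D) + card (?X - B D)) choose card (A D))"
      by (simp add: g_def)
  qed
  also have "\<dots> \<le> 1"
  proof (rule bollobas_set_pairs[of ?X])
    fix D E assume DE: "D \<in> ?K" "E \<in> ?K" "D \<noteq> E"
    \<comment> \<open>The corners are themselves members, \<open>A D \<in> D\<close> and
      \<open>B E \<in> E\<close>, so an inclusion would force \<open>D = E\<close>.\<close>
    then have "\<not> A D \<subseteq> B E"
      using component_sets_eqI[OF finF] AB by (metis atLeastAtMost_iff order_refl)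
    then show "A D \<inter> (?X - B E) \<noteq> {}"
      using AB[OF DE(1)] by blast
  qed (use finK AB in auto)
  finally show ?thesis .
qed

end
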